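(* There is a sequence of positive constants $(a_i)_{i\ge 0}$ such that for every graph $G$ without isolated vertices, every uniform NROBP realizing $\phi(G)$ has at least $2^{\mathrm{dmw}(G)/a_x}$ nodes, where $x$ is the maximum degree of $G$.
   Context: For a graph $G$ with no isolated vertices, $\phi(G)$ is the monotone 2-CNF with variables $\{x_v : v\in V(G)\}$ and clauses $\{(x_u\vee x_v): \{u,v\}\in E(G)\}$. An NROBP realizing a Boolean function $F$ is a connected directed acyclic graph (multiple edges allowed) with one root and one leaf, in which some edges are labelled by literals of variables of $F$ so that no directed path contains two edges labelled by literals of the same variable; writing $A(P)$ for the set of literals on a path $P$: (i) for every root-to-leaf path $P$, every extension of $A(P)$ to a total assignment satisfies $F$; (ii) for every satisfying assignment $A$ of $F$ there is a root-to-leaf path $P$ with $A(P)\subseteq A$. It is uniform if any two paths from the root to the same node are labelled by literals of the same set of variables, and every root-to-leaf path is labelled by literals of all variables of $F$. A matching $M$ of $G$ is distant if no two vertices incident to distinct edges of $M$ are adjacent or have a common neighbour. $\mathrm{dmw}(G)$ (distant matching width) is the minimum, over all orderings $SV$ of $V(G)$, of the maximum, over all prefixes $V_1$ of $SV$, of the size of a largest distant matching all of whose edges have one end in $V_1$ and the other in $V(G)\setminus V_1$. *)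

theory Defs
  imports
    Complex_Main
    "HOL-Library.Sublist"
    "HOL-Combinatorics.Multiset_Permutations"
    "Graph_Theory.Graph_Theory"
begin

section \<open>Finite simple graphs\<close>

text \<open>A graph is given by its vertex set \<open>V\<close> and its set \<open>E\<close> of two-element edges.\<close>

definition simple_graph :: "'v set \<Rightarrow> 'v set set \<Rightarrow> bool" where
  "simple_graph V E \<longleftrightarrow> finite V \<and> (\<forall>e\<in>E. e \<subseteq> V \<and> card e = 2)"

definition no_isolated_vertices :: "'v set \<Rightarrow> 'v set set \<Rightarrow> bool" where
  "no_isolated_vertices V E \<longleftrightarrow> (\<forall>v\<in>V. \<exists>e\<in>E. v \<in> e)"

definition vertex_degree :: "'v set set \<Rightarrow> 'v \<Rightarrow> nat" where
  "vertex_degree E v = card {e\<in>E. v \<in> e}"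

text \<open>Inserting \<open>0\<close> only matters for the graph without vertices, whose maximum degree is \<open>0\<close>.\<close>

definition max_degree :: "'v set \<Rightarrow> 'v set set \<Rightarrow> nat" where
  "max_degree V E = Max (insert 0 (vertex_degree E ` V))"

section \<open>Distant matching width\<close>

definition matching :: "'v set set \<Rightarrow> 'v set set \<Rightarrow> bool" where
  "matching E M \<longleftrightarrow> M \<subseteq> E \<and> (\<forall>e\<in>M. \<forall>f\<in>M. e \<noteq> f \<longrightarrow> e \<inter> f = {})"

definition distant_matching :: "'v set set \<Rightarrow> 'v set set \<Rightarrow> bool" where
  "distant_matching E M \<longleftrightarrow> matching E M \<and>
     (\<forall>e\<in>M. \<forall>f\<in>M. e \<noteq> f \<longrightarrow>
        (\<forall>u\<in>e. \<forall>v\<in>f. {u, v} \<notin> E \<and> \<not> (\<exists>w. {u, w} \<in> E \<and> {v, w} \<in> E)))"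

definition crosses :: "'v set \<Rightarrow> 'v set \<Rightarrow> 'v set \<Rightarrow> bool" where
  "crosses V V1 e \<longleftrightarrow> (\<exists>u\<in>V1. \<exists>v\<in>V - V1. e = {u, v})"

definition prefix_width :: "'v set \<Rightarrow> 'v set set \<Rightarrow> 'v set \<Rightarrow> nat" where
  "prefix_width V E V1 = Max {card M | M. distant_matching E M \<and> (\<forall>e\<in>M. crosses V V1 e)}"

definition ordering_width :: "'v set \<Rightarrow> 'v set set \<Rightarrow> 'v list \<Rightarrow> nat" where
  "ordering_width V E SV = Max {prefix_width V E (set ys) | ys. prefix ys SV}"

definition dmw :: "'v set \<Rightarrow> 'v set set \<Rightarrow> nat" where
  "dmw V E = Min (ordering_width V E ` permutations_of_set V)"

section \<open>Boolean functions and monotone 2-CNFs\<close>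

datatype 'v literal = Pos (var: 'v) | Neg (var: 'v)

text \<open>
  An assignment is a consistent set of literals; a total assignment to \<open>X\<close> contains exactly one
  literal of each variable in \<open>X\<close> and no other literal. A Boolean function is a set \<open>X\<close> of
  variables together with a predicate \<open>F\<close> on literal sets, of which only the values at total
  assignments to \<open>X\<close> are used.
\<close>

definition total_assignment :: "'v set \<Rightarrow> 'v literal set \<Rightarrow> bool" where
  "total_assignment X A \<longleftrightarrow> var ` A \<subseteq> X \<and> (\<forall>x\<in>X. (Pos x \<in> A) \<noteq> (Neg x \<in> A))"

definition cnf_sat :: "'v literal set set \<Rightarrow> 'v literal set \<Rightarrow> bool" where
  "cnf_sat C A \<longleftrightarrow> (\<forall>c\<in>C. \<exists>l\<in>c. l \<in> A)"

text \<open>The variables of the formula are the vertices themselves.\<close>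

definition phi :: "'v set set \<Rightarrow> 'v literal set set" where
  "phi E = {{Pos u, Pos v} | u v. {u, v} \<in> E}"

section \<open>Non-deterministic read-once branching programs\<close>

definition is_root :: "('n, 'e) pre_digraph \<Rightarrow> 'n \<Rightarrow> bool" where
  "is_root Z r \<longleftrightarrow> r \<in> verts Z \<and> in_arcs Z r = {}"

definition is_leaf :: "('n, 'e) pre_digraph \<Rightarrow> 'n \<Rightarrow> bool" where
  "is_leaf Z t \<longleftrightarrow> t \<in> verts Z \<and> out_arcs Z t = {}"

text \<open>
  \<open>lab e = None\<close> means that the edge \<open>e\<close> is unlabelled. A path is the list of its edges, and
  \<open>path_lits lab p\<close> is the set of literals labelling them.
\<close>

definition path_lits :: "('e \<Rightarrow> 'v literal option) \<Rightarrow> 'e list \<Rightarrow> 'v literal set" where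
  "path_lits lab p = {l. \<exists>e\<in>set p. lab e = Some l}"

locale nrobp = fin_digraph Z
  for Z :: "('n, 'e) pre_digraph" +
  fixes lab :: "'e \<Rightarrow> 'v literal option"
    and X :: "'v set"
    and F :: "'v literal set \<Rightarrow> bool"
  assumes is_connected: "Digraph_Component.connected Z"
    and no_cycle: "\<not> (\<exists>p. cycle p)"
    and unique_root: "\<exists>!r. is_root Z r"
    and unique_leaf: "\<exists>!t. is_leaf Z t"
    and lab_vars: "\<And>e l. e \<in> arcs Z \<Longrightarrow> lab e = Some l \<Longrightarrow> var l \<in> X"
    and read_once: "\<And>u p v i j l l'. apath u p v \<Longrightarrow> i < length p \<Longrightarrow> j < length p \<Longrightarrow> i \<noteq> j \<Longrightarrow>
      lab (p ! i) = Some l \<Longrightarrow> lab (p ! j) = Some l' \<Longrightarrow> var l \<noteq> var l'"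
    and sound: "\<And>r p t A. is_root Z r \<Longrightarrow> is_leaf Z t \<Longrightarrow> apath r p t \<Longrightarrow>
      total_assignment X A \<Longrightarrow> path_lits lab p \<subseteq> A \<Longrightarrow> F A"
    and complete: "\<And>A. total_assignment X A \<Longrightarrow> F A \<Longrightarrow>
      \<exists>r p t. is_root Z r \<and> is_leaf Z t \<and> apath r p t \<and> path_lits lab p \<subseteq> A"

locale uniform_nrobp = nrobp Z lab X F
  for Z :: "('n, 'e) pre_digraph"
    and lab :: "'e \<Rightarrow> 'v literal option"
    and X :: "'v set"
    and F :: "'v literal set \<Rightarrow> bool" +
  assumes uniform: "\<And>r p q v. is_root Z r \<Longrightarrow> apath r p v \<Longrightarrow> apath r q v \<Longrightarrow>
      var ` path_lits lab p = var ` path_lits lab q"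
    and all_vars: "\<And>r p t. is_root Z r \<Longrightarrow> is_leaf Z t \<Longrightarrow> apath r p t \<Longrightarrow>
      var ` path_lits lab p = X"

end

theory Submission
  imports Defs
begin

text \<open>
  The satisfying assignments of \<open>phi E\<close> are the vertex covers \<open>C\<close>. The labels along an accepting path
  order \<open>V\<close>, so some node of the path cuts that order at a prefix crossed by a distant matching of
  size at least \<open>dmw\<close>. By uniformity this prefix depends on the node only. If neither end of a
  crossing edge lay in all covers routed through the node, splicing two paths would yield an
  accepting path falsifying the clause of that edge. Hence all covers routed through one node
  contain a common set of \<open>dmw\<close> vertices. With \<open>x\<close> the maximum degree, at most a fraction
  \<open>1 / (1 + 2\<^sup>-\<^sup>x)^dmw\<close> of all covers does so: requiring one more vertex \<open>w\<close> divides the number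
  of covers by at least \<open>1 + 2\<^sup>-\<^sup>x\<close>, because \<open>w\<close> can be traded for its neighbours.
\<close>

section \<open>Counting vertex covers\<close>

definition vertex_covers :: "'v set \<Rightarrow> 'v set set \<Rightarrow> 'v set set" where
  "vertex_covers V E = {C. C \<subseteq> V \<and> (\<forall>e\<in>E. e \<inter> C \<noteq> {})}"

definition neighbours :: "'v set set \<Rightarrow> 'v \<Rightarrow> 'v set" where
  "neighbours E w = {v. {w, v} \<in> E}"

lemma finite_edges: "simple_graph V E \<Longrightarrow> finite E"
  unfolding simple_graph_def by (meson PowI finite_Pow_iff finite_subset subsetI)

lemma edge_ends_distinct: "simple_graph V E \<Longrightarrow> {u, v} \<in> E \<Longrightarrow> u \<noteq> v"
  unfolding simple_graph_def by fastforce

lemma neighbours_subset: "simple_graph V E \<Longrightarrow> neighbours E w \<subseteq> V - {w}"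
proof
  fix v assume sg: "simple_graph V E" and "v \<in> neighbours E w"
  then have e: "{w, v} \<in> E" by (simp add: neighbours_def)
  with sg have "{w, v} \<subseteq> V" unfolding simple_graph_def by blast
  with edge_ends_distinct[OF sg e] show "v \<in> V - {w}" by simp
qed

lemma edge_eq_pair:
  assumes "simple_graph V E" "e \<in> E" "w \<in> e"
  obtains v where "e = {w, v}"
proof -
  have "card e = 2" using assms(1,2) by (simp add: simple_graph_def)
  then obtain x y where "e = {x, y}" by (auto simp: card_2_iff)
  with assms(3) that show thesis by (cases "w = x") (auto simp: insert_commute)
qed

lemma card_neighbours_le:
  assumes "simple_graph V E" "w \<in> V"
  shows "card (neighbours E w) \<le> max_degree V E"
proof -
  have fin: "finite V" using assms(1) by (simp add: simple_graph_def)
  have "card (neighbours E w) \<le> vertex_degree E w"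
    unfolding vertex_degree_def
  proof (rule card_inj_on_le)
    show "inj_on (\<lambda>v. {w, v}) (neighbours E w)"
      by (auto simp: inj_on_def doubleton_eq_iff)
    show "(\<lambda>v. {w, v}) ` neighbours E w \<subseteq> {e \<in> E. w \<in> e}"
      by (auto simp: neighbours_def)
    show "finite {e \<in> E. w \<in> e}"
      using finite_edges[OF assms(1)] by simp
  qed
  also have "\<dots> \<le> max_degree V E"
    unfolding max_degree_def using fin assms(2) by (intro Max_ge) auto
  finally show ?thesis .
qed

lemma finite_vertex_covers: "simple_graph V E \<Longrightarrow> finite (vertex_covers V E)"
  unfolding vertex_covers_def simple_graph_def by simp

lemma vertices_vertex_cover: "simple_graph V E \<Longrightarrow> V \<in> vertex_covers V E"
  unfolding vertex_covers_def simple_graph_def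
  by (fastforce dest: inf.absorb1)

text \<open>An edge at \<open>w\<close> is covered by its other end, a neighbour distinct from
  \<open>w\<close>; any other edge keeps the vertex of \<open>C\<close> that covered it.\<close>

lemma trade_vertex_cover:
  assumes "simple_graph V E" "C \<in> vertex_covers V E"
  shows "(C \<union> neighbours E w) - {w} \<in> vertex_covers V E"
proof -
  have "e \<inter> ((C \<union> neighbours E w) - {w}) \<noteq> {}" if eE: "e \<in> E" for e
  proof (cases "w \<in> e")
    case True
    then obtain v where "e = {w, v}" using edge_eq_pair[OF assms(1) eE] by blast
    with eE edge_ends_distinct[OF assms(1)] show ?thesis
      by (auto simp: neighbours_def)
  next
    case False
    with eE assms(2) show ?thesis by (auto simp: vertex_covers_def)
  qed
  with neighbours_subset[OF assms(1)] assms(2) show ?thesis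
    unfolding vertex_covers_def by blast
qed

text \<open>Trading \<open>w\<close> maps the covers \<open>S\<close> with \<open>w\<close> into the
  covers \<open>T\<close> without it and forgets only which neighbours of \<open>w\<close> were
  present. Hence \<open>card S\<close> is at most \<open>2 ^ d * card T\<close> for the maximum
  degree \<open>d\<close>, and \<open>S\<close> and \<open>T\<close> together are the covers
  containing \<open>W\<close>.\<close>

lemma card_covers_insert:
  assumes sg: "simple_graph V E" and w: "w \<in> V" "w \<notin> W"
  shows "real (card {C \<in> vertex_covers V E. insert w W \<subseteq> C}) * (1 + 1 / 2 ^ max_degree V E)
    \<le> real (card {C \<in> vertex_covers V E. W \<subseteq> C})"
proof -
  let ?N = "neighbours E w" and ?d = "max_degree V E"
  define S where "S = {C \<in> vertex_covers V E. insert w W \<subseteq> C}"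
  define T where "T = {C \<in> vertex_covers V E. W \<subseteq> C \<and> w \<notin> C}"
  define f where "f = (\<lambda>C. (C \<union> ?N) - {w})"
  have fin: "finite S" "finite T"
    using finite_vertex_covers[OF sg] by (auto simp: S_def T_def)
  have Nsub: "?N \<subseteq> V - {w}" by (rule neighbours_subset[OF sg])
  have finN: "finite ?N"
    using Nsub sg finite_subset unfolding simple_graph_def by blast
  have fS: "f ` S \<subseteq> T"
    using trade_vertex_cover[OF sg] w(2) by (auto simp: S_def T_def f_def)
  \<comment> \<open>Trading alters a cover only at \<open>w\<close> and its neighbours, so its image
    and its trace on the neighbours determine it.\<close>
  have recover: "C = insert w ((f C - ?N) \<union> (C \<inter> ?N))" if "C \<in> S" for C
    using that Nsub by (auto simp: S_def f_def)
  have "card S \<le> card (T \<times> Pow ?N)"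
  proof (rule card_inj_on_le)
    show "inj_on (\<lambda>C. (f C, C \<inter> ?N)) S"
    proof (rule inj_onI)
      fix C D assume CD: "C \<in> S" "D \<in> S" "(f C, C \<inter> ?N) = (f D, D \<inter> ?N)"
      have "C = insert w ((f C - ?N) \<union> (C \<inter> ?N))" by (rule recover[OF CD(1)])
      also have "\<dots> = insert w ((f D - ?N) \<union> (D \<inter> ?N))" using CD(3) by simp
      also have "\<dots> = D" by (rule recover[OF CD(2), symmetric])
      finally show "C = D" .
    qed
    show "(\<lambda>C. (f C, C \<inter> ?N)) ` S \<subseteq> T \<times> Pow ?N" using fS by auto
    show "finite (T \<times> Pow ?N)" using fin finN by simp
  qed
  also have "\<dots> = card T * 2 ^ card ?N"
    using finN by (simp add: card_cartesian_product card_Pow)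
  also have "\<dots> \<le> card T * 2 ^ ?d"
    using card_neighbours_le[OF sg w(1)] by (simp add: power_increasing)
  finally have "real (card S) \<le> real (card T) * 2 ^ ?d"
    by (metis of_nat_le_iff of_nat_mult of_nat_numeral of_nat_power)
  then have "real (card S) / 2 ^ ?d \<le> real (card T)"
    by (simp add: field_simps)
  moreover have "{C \<in> vertex_covers V E. W \<subseteq> C} = S \<union> T" "S \<inter> T = {}"
    by (auto simp: S_def T_def)
  then have "card {C \<in> vertex_covers V E. W \<subseteq> C} = card S + card T"
    using fin by (simp add: card_Un_disjoint)
  ultimately show ?thesis
    unfolding S_def[symmetric] by (simp add: algebra_simps)
qed

lemma card_covers_superset_le:
  assumes sg: "simple_graph V E" and "W \<subseteq> V"
  shows "real (card {C \<in> vertex_covers V E. W \<subseteq> C}) * (1 + 1 / 2 ^ max_degree V E) ^ card W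
    \<le> real (card (vertex_covers V E))"
proof -
  have "finite W" using assms finite_subset unfolding simple_graph_def by blast
  then show ?thesis using assms(2)
  proof (induction W)
    case empty
    then show ?case by simp
  next
    case (insert w W)
    let ?q = "1 + 1 / 2 ^ max_degree V E :: real"
    let ?c = "\<lambda>W. real (card {C \<in> vertex_covers V E. W \<subseteq> C})"
    have "?c (insert w W) * ?q ^ card (insert w W) = ?c (insert w W) * ?q * ?q ^ card W"
      using insert.hyps by simp
    also have "\<dots> \<le> ?c W * ?q ^ card W"
      using card_covers_insert[OF sg, of w W] insert by (intro mult_right_mono) auto
    also have "\<dots> \<le> real (card (vertex_covers V E))"
      using insert by simp
    finally show ?case .
  qed
qed

section \<open>Crossing matchings\<close>

lemma finite_matching_sizes:
  assumes "simple_graph V E"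
  shows "finite {card M | M. distant_matching E M \<and> P M}"
proof (rule finite_subset)
  show "{card M | M. distant_matching E M \<and> P M} \<subseteq> card ` Pow E"
    by (auto simp: distant_matching_def matching_def)
  show "finite (card ` Pow E)"
    using finite_edges[OF assms] by simp
qed

lemma prefix_width_attained:
  assumes "simple_graph V E"
  obtains M where "matching E M" "\<forall>e\<in>M. crosses V V1 e" "card M = prefix_width V E V1"
proof -
  \<comment> \<open>The empty matching makes the set of sizes nonempty, so its maximum is
    attained.\<close>
  have "distant_matching E {}" by (simp add: distant_matching_def matching_def)
  then have "{card M | M. distant_matching E M \<and> (\<forall>e\<in>M. crosses V V1 e)} \<noteq> {}" by blast
  then have "prefix_width V E V1 \<in> {card M | M. distant_matching E M \<and> (\<forall>e\<in>M. crosses V V1 e)}"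
    unfolding prefix_width_def using finite_matching_sizes[OF assms] by (intro Max_in) auto
  with that show thesis by (auto simp: distant_matching_def)
qed

text \<open>The minimum over orderings bounds the width of this one from below, and that width is
  attained at some prefix.\<close>

lemma dmw_le_prefix_width:
  assumes "simple_graph V E" "SV \<in> permutations_of_set V"
  obtains ys where "prefix ys SV" "dmw V E \<le> prefix_width V E (set ys)"
proof -
  have eq: "{prefix_width V E (set ys) | ys. prefix ys SV}
      = (\<lambda>ys. prefix_width V E (set ys)) ` set (prefixes SV)"
    by auto
  then have "ordering_width V E SV \<in> {prefix_width V E (set ys) | ys. prefix ys SV}"
    unfolding ordering_width_def by (intro Max_in) auto
  moreover have "dmw V E \<le> ordering_width V E SV"
    unfolding dmw_def using assms by (intro Min_le) (auto simp: simple_graph_def)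
  ultimately show thesis using that by auto
qed

section \<open>Paths of branching programs\<close>

definition path_vars :: "('e \<Rightarrow> 'v literal option) \<Rightarrow> 'e list \<Rightarrow> 'v list" where
  "path_vars lab p = List.map_filter (\<lambda>e. map_option var (lab e)) p"

lemma set_path_vars: "set (path_vars lab p) = var ` path_lits lab p"
  by (induction p)
    (auto simp: path_vars_def path_lits_def image_iff split: option.splits)

text \<open>Turns a cut of the variable order into a cut of the path, that is, into a node.
  Unlabelled edges at the cut go to the first part.\<close>

lemma prefix_path_vars:
  assumes "prefix ys (path_vars lab p)"
  obtains p1 p2 where "p = p1 @ p2" "path_vars lab p1 = ys"
  using assms
proof (induction p arbitrary: ys thesis)
  case Nil
  then show ?case by (force simp: path_vars_def)
next
  case (Cons e p)
  show ?case
  proof (cases "lab e")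
    case None
    with Cons.prems(2) have "prefix ys (path_vars lab p)" by (simp add: path_vars_def)
    then obtain p1 p2 where "p = p1 @ p2" "path_vars lab p1 = ys" using Cons.IH by blast
    with None show ?thesis
      by (intro Cons.prems(1)[of "e # p1" p2]) (auto simp: path_vars_def)
  next
    case (Some l)
    with Cons.prems(2) have pre: "prefix ys (var l # path_vars lab p)" by (simp add: path_vars_def)
    show ?thesis
    proof (cases ys)
      case Nil
      then show ?thesis by (intro Cons.prems(1)[of "[]" "e # p"]) (auto simp: path_vars_def)
    next
      case (Cons y zs)
      with pre have "prefix zs (path_vars lab p)" "y = var l" by auto
      then obtain p1 p2 where "p = p1 @ p2" "path_vars lab p1 = zs" using Cons.IH by blast
      with Some \<open>ys = y # zs\<close> \<open>y = var l\<close> show ?thesis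
        by (intro Cons.prems(1)[of "e # p1" p2]) (auto simp: path_vars_def)
    qed
  qed
qed

lemma path_lits_append: "path_lits lab (p @ q) = path_lits lab p \<union> path_lits lab q"
  by (auto simp: path_lits_def)

section \<open>Vertex covers as satisfying assignments\<close>

definition cover_assignment :: "'v set \<Rightarrow> 'v set \<Rightarrow> 'v literal set" where
  "cover_assignment V C = Pos ` C \<union> Neg ` (V - C)"

lemma total_cover_assignment: "C \<subseteq> V \<Longrightarrow> total_assignment V (cover_assignment V C)"
  by (auto simp: total_assignment_def cover_assignment_def)

lemma cover_assignment_sat:
  assumes "C \<in> vertex_covers V E"
  shows "cnf_sat (phi E) (cover_assignment V C)"
  unfolding cnf_sat_def
proof
  fix c assume "c \<in> phi E"
  then obtain u v where c: "c = {Pos u, Pos v}" "{u, v} \<in> E" by (auto simp: phi_def)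
  with assms have "{u, v} \<inter> C \<noteq> {}" by (auto simp: vertex_covers_def)
  with c show "\<exists>l\<in>c. l \<in> cover_assignment V C" by (auto simp: cover_assignment_def)
qed

lemma Neg_in_path_lits:
  assumes "w \<in> var ` path_lits lab p" "path_lits lab p \<subseteq> cover_assignment V C" "w \<notin> C"
  shows "Neg w \<in> path_lits lab p"
  using assms by (force simp: cover_assignment_def)

section \<open>Acyclicity and the read-once condition\<close>

context nrobp
begin

text \<open>A repeated node would close a cycle. Consequently, paths that meet at a node can be
  concatenated freely, which splicing relies on.\<close>

lemma apath_eq_awalk: "apath u p v \<longleftrightarrow> awalk u p v"
proof
  assume walk: "awalk u p v"
  have "distinct (awalk_verts u p)"
  proof (rule ccontr)
    assume "\<not> distinct (awalk_verts u p)"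
    then obtain r where "closed_w r"
      using awalk_not_distinct_decomp[OF walk] by (auto simp: closed_w_def)
    then show False using closed_w_imp_cycle no_cycle by blast
  qed
  with walk show "apath u p v" by (simp add: apath_def)
qed (rule awalkI_apath)

lemma apath_lits_consistent:
  assumes "apath u p v" "Pos x \<in> path_lits lab p"
  shows "Neg x \<notin> path_lits lab p"
proof
  assume "Neg x \<in> path_lits lab p"
  with assms obtain i j where ij: "i < length p" "lab (p ! i) = Some (Pos x)"
      "j < length p" "lab (p ! j) = Some (Neg x)"
    by (auto simp: path_lits_def in_set_conv_nth)
  then have "i \<noteq> j" by auto
  with read_once[OF assms(1) ij(1,3) _ ij(2,4)] show False by simp
qed

lemma distinct_path_vars:
  assumes "apath u p v"
  shows "distinct (path_vars lab p)"
  using assms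
proof (induction p arbitrary: u)
  case Nil
  then show ?case by (simp add: path_vars_def)
next
  case (Cons e p)
  have IH: "distinct (path_vars lab p)"
    using Cons by (auto simp: apath_Cons_iff)
  show ?case
  proof (cases "lab e")
    case None
    with IH show ?thesis by (simp add: path_vars_def)
  next
    case (Some l)
    have "var l \<notin> var ` path_lits lab p"
    proof
      assume "var l \<in> var ` path_lits lab p"
      then obtain l' j where j: "var l = var l'" "j < length p" "lab (p ! j) = Some l'"
        by (auto simp: path_lits_def in_set_conv_nth)
      \<comment> \<open>In \<open>e # p\<close>, position \<open>0\<close> is \<open>e\<close> and
        position \<open>Suc j\<close> is the edge \<open>p ! j\<close>.\<close>
      have "var l \<noteq> var l'"
        by (rule read_once[OF Cons.prems, of 0 "Suc j"]) (use Some j in auto)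
      with j show False by simp
    qed
    with IH Some show ?thesis
      by (simp add: path_vars_def set_path_vars[unfolded path_vars_def])
  qed
qed

end

section \<open>Counting the nodes\<close>

text \<open>The last conjunct records that the variables read before \<open>a\<close> form a wide
  prefix. In a uniform program it does not depend on the choice of \<open>p\<close>.\<close>

definition routed_covers ::
  "('n, 'e) pre_digraph \<Rightarrow> ('e \<Rightarrow> 'v literal option) \<Rightarrow> 'v set \<Rightarrow> 'v set set \<Rightarrow> nat \<Rightarrow> 'n
    \<Rightarrow> 'v set set" where
  "routed_covers Z lab V E d a = {C \<in> vertex_covers V E. \<exists>r p q t.
     is_root Z r \<and> is_leaf Z t \<and> pre_digraph.apath Z r p a \<and> pre_digraph.apath Z a q t \<and>
     path_lits lab (p @ q) \<subseteq> cover_assignment V C \<and>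
     d \<le> prefix_width V E (var ` path_lits lab p)}"

context uniform_nrobp
begin

text \<open>Uniformity gives at least one literal per variable and read-once at most one, so
  \<open>sound\<close> applies to the literals of the path themselves.\<close>

lemma total_path_lits:
  assumes "is_root Z r" "is_leaf Z t" "apath r p t"
  shows "total_assignment X (path_lits lab p)"
proof -
  have vars: "var ` path_lits lab p = X" by (rule all_vars[OF assms])
  have "Pos x \<in> path_lits lab p \<or> Neg x \<in> path_lits lab p" if "x \<in> X" for x
    using that unfolding vars[symmetric] by (metis image_iff literal.collapse(1) literal.exhaust_sel)
  with vars apath_lits_consistent[OF assms(3)] show ?thesis
    unfolding total_assignment_def by auto
qed

lemma covers_routed:
  assumes sg: "simple_graph X E" and F: "F = cnf_sat (phi E)" and C: "C \<in> vertex_covers X E"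
  shows "\<exists>a\<in>verts Z. C \<in> routed_covers Z lab X E (dmw X E) a"
proof -
  have "C \<subseteq> X" using C by (simp add: vertex_covers_def)
  then obtain r p t where p: "is_root Z r" "is_leaf Z t" "apath r p t"
      "path_lits lab p \<subseteq> cover_assignment X C"
    using complete[OF total_cover_assignment] cover_assignment_sat[OF C] F by blast
  have "path_vars lab p \<in> permutations_of_set X"
    using distinct_path_vars[OF p(3)] all_vars[OF p(1-3)]
    by (auto simp: permutations_of_set_def set_path_vars)
  then obtain ys where ys: "prefix ys (path_vars lab p)" "dmw X E \<le> prefix_width X E (set ys)"
    using dmw_le_prefix_width[OF sg] by blast
  then obtain p1 p2 where split: "p = p1 @ p2" "path_vars lab p1 = ys"
    using prefix_path_vars by blast
  \<comment> \<open>The node at which the accepting path of \<open>C\<close> has read exactly the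
    wide prefix \<open>ys\<close>.\<close>
  define a where "a = awlast r p1"
  have paths: "apath r p1 a" "apath a p2 t"
    using p(3) unfolding split(1) apath_append_iff a_def by auto
  then have "a \<in> verts Z" by (auto simp: apath_def)
  moreover have "C \<in> routed_covers Z lab X E (dmw X E) a"
    unfolding routed_covers_def using C p paths ys(2) split
    by (auto simp: set_path_vars[symmetric])
  ultimately show ?thesis by blast
qed

text \<open>If \<open>C\<close> misses \<open>u\<close> and \<open>D\<close> misses
  \<open>v\<close>, follow the path of \<open>C\<close> up to \<open>a\<close> and that of
  \<open>D\<close> from there. This reads \<open>Neg u\<close> before \<open>a\<close> and
  \<open>Neg v\<close> after it, so an accepting path falsifies the clause of the edge.\<close>

lemma crossing_edge_end_common:
  assumes F: "F = cnf_sat (phi E)"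
    and r: "is_root Z r" "apath r p0 a"
    and e: "e \<in> E" "crosses X (var ` path_lits lab p0) e"
  shows "\<exists>w\<in>e. \<forall>C\<in>routed_covers Z lab X E d a. w \<in> C"
proof (rule ccontr)
  assume none: "\<not> ?thesis"
  obtain u v where uv: "e = {u, v}" "u \<in> var ` path_lits lab p0" "v \<in> X" "v \<notin> var ` path_lits lab p0"
    using e(2) unfolding crosses_def by blast
  obtain C D where C: "C \<in> routed_covers Z lab X E d a" "u \<notin> C"
    and D: "D \<in> routed_covers Z lab X E d a" "v \<notin> D"
    using none uv(1) by auto
  obtain r1 p1 q1 t1 where 1: "is_root Z r1" "apath r1 p1 a"
      "path_lits lab p1 \<subseteq> cover_assignment X C"
    using C(1) unfolding routed_covers_def path_lits_append by blast
  obtain r2 p2 q2 t2 where 2: "is_root Z r2" "is_leaf Z t2" "apath r2 p2 a" "apath a q2 t2"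
      "path_lits lab q2 \<subseteq> cover_assignment X D"
    using D(1) unfolding routed_covers_def path_lits_append by blast
  have same: "r1 = r" "r2 = r"
    using unique_root r(1) 1(1) 2(1) by auto
  \<comment> \<open>The path of \<open>C\<close> may differ from \<open>p0\<close>, but by
    uniformity it too reads \<open>u\<close> and not \<open>v\<close> before
    \<open>a\<close>.\<close>
  have vars1: "var ` path_lits lab p1 = var ` path_lits lab p0"
    using uniform[OF r(1) _ r(2)] 1(2) same by blast
  have splice: "apath r (p1 @ q2) t2"
    using 1(2) 2(4) same awalk_appendI unfolding apath_eq_awalk by blast
  \<comment> \<open>The spliced path reads every variable, so \<open>v\<close> must be read after
    \<open>a\<close>, where the literals agree with \<open>D\<close>.\<close>
  have "var ` path_lits lab p1 \<union> var ` path_lits lab q2 = X"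
    using all_vars[OF r(1) 2(2) splice] by (simp add: path_lits_append image_Un)
  then have "v \<in> var ` path_lits lab q2"
    using uv(3,4) vars1 by blast
  then have "Neg u \<in> path_lits lab (p1 @ q2)" "Neg v \<in> path_lits lab (p1 @ q2)"
    using Neg_in_path_lits[OF _ 1(3) C(2)] Neg_in_path_lits[OF _ 2(5) D(2)] uv(2) vars1
    by (auto simp: path_lits_append)
  then have no_pos: "Pos u \<notin> path_lits lab (p1 @ q2)" "Pos v \<notin> path_lits lab (p1 @ q2)"
    using apath_lits_consistent[OF splice] by auto
  have sat: "cnf_sat (phi E) (path_lits lab (p1 @ q2))"
    using sound[OF r(1) 2(2) splice total_path_lits[OF r(1) 2(2) splice]] F by simp
  have "{Pos u, Pos v} \<in> phi E"
    using e(1) uv(1) by (auto simp: phi_def)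
  then have "\<exists>l\<in>{Pos u, Pos v}. l \<in> path_lits lab (p1 @ q2)"
    using sat unfolding cnf_sat_def by (rule bspec[rotated])
  with no_pos show False by simp
qed

text \<open>Choosing a common end of each edge of a widest crossing matching gives distinct
  vertices, since the edges are disjoint. All routed covers contain these at least \<open>d\<close>
  vertices.\<close>

lemma card_routed_covers_le:
  assumes sg: "simple_graph X E" and F: "F = cnf_sat (phi E)"
  shows "real (card (routed_covers Z lab X E d a)) * (1 + 1 / 2 ^ max_degree X E) ^ d
    \<le> real (card (vertex_covers X E))"
proof (cases "routed_covers Z lab X E d a = {}")
  case True
  then show ?thesis by simp
next
  case False
  let ?q = "1 + 1 / 2 ^ max_degree X E :: real"
  obtain r p where rp: "is_root Z r" "apath r p a" "d \<le> prefix_width X E (var ` path_lits lab p)"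
    using False unfolding routed_covers_def by blast
  obtain M where M: "matching E M" "\<forall>e\<in>M. crosses X (var ` path_lits lab p) e"
      "card M = prefix_width X E (var ` path_lits lab p)"
    using prefix_width_attained[OF sg] by blast
  have "\<forall>e\<in>M. \<exists>w\<in>e. \<forall>C\<in>routed_covers Z lab X E d a. w \<in> C"
    using crossing_edge_end_common[OF F rp(1,2)] M by (auto simp: matching_def)
  then obtain g where g: "\<And>e. e \<in> M \<Longrightarrow> g e \<in> e"
      "\<And>e C. e \<in> M \<Longrightarrow> C \<in> routed_covers Z lab X E d a \<Longrightarrow> g e \<in> C"
    by metis
  have "inj_on g M"
  proof (rule inj_onI)
    fix e f assume "e \<in> M" "f \<in> M" "g e = g f"
    then have "g e \<in> e \<inter> f" using g(1)[of e] g(1)[of f] by simp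
    with \<open>e \<in> M\<close> \<open>f \<in> M\<close> M(1) show "e = f" unfolding matching_def by blast
  qed
  then have d: "d \<le> card (g ` M)"
    using M(3) rp(3) by (simp add: card_image)
  have "g ` M \<subseteq> X"
  proof
    fix w assume "w \<in> g ` M"
    then obtain e where "e \<in> M" "w \<in> e" using g(1) by blast
    moreover from this have "e \<in> E" using M(1) by (auto simp: matching_def)
    then have "e \<subseteq> X" using sg by (simp add: simple_graph_def)
    ultimately show "w \<in> X" by blast
  qed
  have "routed_covers Z lab X E d a \<subseteq> {C \<in> vertex_covers X E. g ` M \<subseteq> C}"
    using g(2) routed_covers_def[of Z lab X E d a] by blast
  then have "card (routed_covers Z lab X E d a) \<le> card {C \<in> vertex_covers X E. g ` M \<subseteq> C}"
    using finite_vertex_covers[OF sg] by (intro card_mono) auto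
  then have "real (card (routed_covers Z lab X E d a)) * ?q ^ d
      \<le> real (card {C \<in> vertex_covers X E. g ` M \<subseteq> C}) * ?q ^ card (g ` M)"
    using d by (intro mult_mono power_increasing) auto
  also have "\<dots> \<le> real (card (vertex_covers X E))"
    by (rule card_covers_superset_le[OF sg \<open>g ` M \<subseteq> X\<close>])
  finally show ?thesis .
qed

text \<open>A union bound: the nodes together route all covers, while each routes at most a fraction
  \<open>1 / ?q ^ dmw X E\<close> of them.\<close>

lemma card_verts_ge:
  assumes sg: "simple_graph X E" and F: "F = cnf_sat (phi E)"
  shows "(1 + 1 / 2 ^ max_degree X E) ^ dmw X E \<le> real (card (verts Z))"
proof -
  let ?q = "1 + 1 / 2 ^ max_degree X E :: real"
  let ?R = "routed_covers Z lab X E (dmw X E)"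
  let ?n = "real (card (vertex_covers X E))"
  \<comment> \<open>The whole vertex set is a cover, which permits the final division by
    \<open>?n\<close>.\<close>
  have pos: "?n > 0"
    using finite_vertex_covers[OF sg] vertices_vertex_cover[OF sg] by (auto simp: card_gt_0_iff)
  have finR: "finite (?R a)" for a
    using finite_vertex_covers[OF sg] by (auto simp: routed_covers_def)
  have "vertex_covers X E \<subseteq> (\<Union>a\<in>verts Z. ?R a)"
    using covers_routed[OF sg F] by blast
  then have "card (vertex_covers X E) \<le> card (\<Union>a\<in>verts Z. ?R a)"
    using finR by (intro card_mono) auto
  also have "\<dots> \<le> (\<Sum>a\<in>verts Z. card (?R a))"
    by (rule card_UN_le) simp
  finally have "?n \<le> (\<Sum>a\<in>verts Z. real (card (?R a)))"
    by (metis of_nat_le_iff of_nat_sum)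
  then have "?n * ?q ^ dmw X E \<le> (\<Sum>a\<in>verts Z. real (card (?R a))) * ?q ^ dmw X E"
    by (intro mult_right_mono) auto
  also have "\<dots> = (\<Sum>a\<in>verts Z. real (card (?R a)) * ?q ^ dmw X E)"
    by (rule sum_distrib_right)
  also have "\<dots> \<le> (\<Sum>a\<in>verts Z. ?n)"
    by (intro sum_mono card_routed_covers_le[OF sg F])
  finally show ?thesis
    using pos by (simp add: mult.commute)
qed

end

theorem theorem2:
  shows "\<exists>a :: nat \<Rightarrow> real. (\<forall>i. a i > 0) \<and>
    (\<forall>(V :: 'v set) E. simple_graph V E \<and> no_isolated_vertices V E \<longrightarrow>
      (\<forall>(Z :: ('n, 'e) pre_digraph) lab. uniform_nrobp Z lab V (cnf_sat (phi E)) \<longrightarrow>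
        real (card (verts Z)) \<ge> 2 powr (real (dmw V E) / a (max_degree V E))))"
proof -
  \<comment> \<open>Chosen so that \<open>2 powr (1 / a i) = 1 + 1 / 2 ^ i\<close>; positive because
    the logarithm is taken of a number above 1.\<close>
  define a :: "nat \<Rightarrow> real" where "a = (\<lambda>i. 1 / log 2 (1 + 1 / 2 ^ i))"
  have "a i > 0" for i
    unfolding a_def by (intro divide_pos_pos) (auto simp: zero_less_log_cancel_iff add_pos_pos)
  moreover have "2 powr (real (dmw V E) / a (max_degree V E)) \<le> real (card (verts Z))"
    if G: "simple_graph V E" and U: "uniform_nrobp Z lab V (cnf_sat (phi E))"
    for V :: "'v set" and E and Z :: "('n, 'e) pre_digraph" and lab
  proof -
    let ?q = "1 + 1 / 2 ^ max_degree V E :: real"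
    have q: "?q > 0" by (intro add_pos_pos) auto
    have "real (dmw V E) / a (max_degree V E) = log 2 ?q * real (dmw V E)"
      by (simp add: a_def)
    then have "2 powr (real (dmw V E) / a (max_degree V E)) = (2 powr log 2 ?q) powr real (dmw V E)"
      by (simp only: powr_powr)
    also have "2 powr log 2 ?q = ?q"
      using q by (intro powr_log_cancel) auto
    also have "?q powr real (dmw V E) = ?q ^ dmw V E"
      by (rule powr_realpow[OF q])
    also have "\<dots> \<le> real (card (verts Z))"
      by (rule uniform_nrobp.card_verts_ge[OF U G refl])
    finally show ?thesis .
  qed
  ultimately show ?thesis by blast
qed

end
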